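(* Let $T>0$, $n\in\mathbb{N}$, $p\in(1,\infty)$, and let $\{\alpha_j\}_{j=1}^n\subset(0,1]$ be such that $\alpha_{j_0}=1/p$ for some $j_0\in\{1,\dots,n\}$. Then there exist a Carathéodory function $f=(f_1,\dots,f_n):\mathbb{R}^n\times[0,T]\to\mathbb{R}^n$, for which there are $\gamma\in L^p(0,T)$ and a constant $C>0$ with $$\|f(x,t)\|_{\mathbb{R}^n}\le C\|x\|_{\mathbb{R}^n}+\gamma(t)\quad\text{for all }x\in\mathbb{R}^n\text{ and almost every }t\in[0,T],$$ and a vector $\xi=(\xi_1,\dots,\xi_n)\in\mathbb{R}^n$, such that the Cauchy problem $${}^C\!D_t^{\alpha_j}\varphi_j(t)=f_j\big(\varphi_1(t),\dots,\varphi_n(t),t\big)\ \text{ for a.e. } t\in[0,T],\qquad \varphi_j(0)=\xi_j,\qquad j=1,\dots,n,$$ has no solution $\varphi:[0,T]\to\mathbb{R}^n$.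
   Context: $\|\cdot\|_{\mathbb{R}^n}$ is a fixed (say Euclidean) norm on $\mathbb{R}^n$. Carathéodory function: $f:\mathbb{R}^n\times[0,T]\to\mathbb{R}^n$ such that (i) $x\mapsto f(x,t)$ is continuous for almost every $t\in[0,T]$; (ii) $t\mapsto f(x,t)$ is Lebesgue measurable for every $x\in\mathbb{R}^n$. Riemann–Liouville fractional integral of order $\alpha>0$ of $g\in L^1(0,T;\mathbb{R}^m)$: $J_t^\alpha g(t)=\frac{1}{\Gamma(\alpha)}\int_0^t(t-s)^{\alpha-1}g(s)\,ds$ for a.e. $t\in[0,T]$. Caputo fractional derivative of order $\alpha\in(0,1)$ of $g\in C([0,T];\mathbb{R}^m)$ with $J_t^{1-\alpha}g\in W^{1,1}(0,T;\mathbb{R}^m)$: ${}^C\!D_t^\alpha g(t)=\frac{d}{dt}\{J_t^{1-\alpha}[g(t)-g(0)]\}$ for a.e. $t\in[0,T]$, where $d/dt$ is the weak derivative. For $\alpha=1$, ${}^C\!D_t^1 g=g'$ is the usual weak derivative of $g\in W^{1,1}(0,T;\mathbb{R}^m)$. Solution: $\varphi:[0,T]\to\mathbb{R}^n$ is a solution of the Cauchy problem on $[0,T]$ if $\varphi\in C([0,T];\mathbb{R}^n)$, the Caputo derivatives ${}^C\!D_t^{\alpha_j}\varphi_j$ exist in the sense above with $({}^C\!D_t^{\alpha_1}\varphi_1,\dots,{}^C\!D_t^{\alpha_n}\varphi_n)\in L^p(0,T;\mathbb{R}^n)$, and $\varphi$ satisfies the equations and the initial conditions. *)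

theory Defs
  imports "HOL-Analysis.Analysis"
begin

text \<open>
  All notions below concern functions on the interval \<open>[0, T]\<close>; such functions are represented by
  total functions on \<open>real\<close>, and every definition depends only on their values on \<open>[0, T]\<close>.
\<close>

definition caratheodory :: "real \<Rightarrow> ('a::euclidean_space \<Rightarrow> real \<Rightarrow> 'b::euclidean_space) \<Rightarrow> bool"
  where "caratheodory T f \<longleftrightarrow>
    (AE t in lebesgue_on {0..T}. continuous_on UNIV (\<lambda>x. f x t)) \<and>
    (\<forall>x. (\<lambda>t. f x t) \<in> borel_measurable (lebesgue_on {0..T}))"

definition in_Lp :: "real \<Rightarrow> real \<Rightarrow> (real \<Rightarrow> 'a::euclidean_space) \<Rightarrow> bool"
  where "in_Lp p T g \<longleftrightarrow>
    g \<in> borel_measurable (lebesgue_on {0..T}) \<and>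
    integrable (lebesgue_on {0..T}) (\<lambda>t. norm (g t) powr p)"

text \<open>
  Test functions in \<open>C\<^sub>c\<^sup>\<infinity>(0, T)\<close>; the support is automatically compact, being closed and contained
  in a bounded interval.
\<close>

definition test_function :: "real \<Rightarrow> (real \<Rightarrow> real) \<Rightarrow> bool"
  where "test_function T \<psi> \<longleftrightarrow>
    (\<forall>k x. (deriv ^^ k) \<psi> differentiable (at x)) \<and>
    closure {x. \<psi> x \<noteq> 0} \<subseteq> {0<..<T}"

text \<open>\<open>g \<in> W\<^sup>1\<^sup>,\<^sup>1(0, T)\<close> with weak derivative \<open>h\<close>, which is determined only up to null sets.\<close>

definition has_weak_deriv :: "real \<Rightarrow> (real \<Rightarrow> 'a::euclidean_space) \<Rightarrow> (real \<Rightarrow> 'a) \<Rightarrow> bool"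
  where "has_weak_deriv T g h \<longleftrightarrow>
    integrable (lebesgue_on {0..T}) g \<and>
    integrable (lebesgue_on {0..T}) h \<and>
    (\<forall>\<psi>. test_function T \<psi> \<longrightarrow>
      (\<integral>t. deriv \<psi> t *\<^sub>R g t \<partial>lebesgue_on {0..T}) = - (\<integral>t. \<psi> t *\<^sub>R h t \<partial>lebesgue_on {0..T}))"

definition in_W11 :: "real \<Rightarrow> (real \<Rightarrow> 'a::euclidean_space) \<Rightarrow> bool"
  where "in_W11 T g \<longleftrightarrow> (\<exists>h. has_weak_deriv T g h)"

text \<open>
  Riemann--Liouville integral. For integrable \<open>g\<close> the integrand is integrable for almost every \<open>t\<close>;
  on the exceptional null set the Bochner integral returns the default value \<open>0\<close>.
\<close>

definition RL_integral :: "real \<Rightarrow> (real \<Rightarrow> 'a::euclidean_space) \<Rightarrow> real \<Rightarrow> 'a"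
  where "RL_integral \<alpha> g t =
    (1 / Gamma \<alpha>) *\<^sub>R (\<integral>s. (t - s) powr (\<alpha> - 1) *\<^sub>R g s \<partial>lebesgue_on {0..t})"

text \<open>
  The Caputo derivative of order \<open>\<alpha> \<in> (0, 1]\<close> of \<open>g\<close> exists and is (a representative of) \<open>d\<close>.
\<close>

definition has_caputo_deriv ::
    "real \<Rightarrow> real \<Rightarrow> (real \<Rightarrow> 'a::euclidean_space) \<Rightarrow> (real \<Rightarrow> 'a) \<Rightarrow> bool"
  where "has_caputo_deriv \<alpha> T g d \<longleftrightarrow>
    (if \<alpha> = 1 then has_weak_deriv T g d
     else continuous_on {0..T} g \<and>
          in_W11 T (RL_integral (1 - \<alpha>) g) \<and>
          has_weak_deriv T (RL_integral (1 - \<alpha>) (\<lambda>s. g s - g 0)) d)"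

definition caputo_solution ::
    "real \<Rightarrow> real \<Rightarrow> ('n::finite \<Rightarrow> real) \<Rightarrow> (real^'n \<Rightarrow> real \<Rightarrow> real^'n) \<Rightarrow> real^'n \<Rightarrow> (real \<Rightarrow> real^'n) \<Rightarrow> bool"
  where "caputo_solution p T \<alpha> f \<xi> \<phi> \<longleftrightarrow>
    continuous_on {0..T} \<phi> \<and>
    (\<exists>D. (\<forall>j. has_caputo_deriv (\<alpha> j) T (\<lambda>t. \<phi> t $ j) (\<lambda>t. D t $ j)) \<and>
         in_Lp p T D \<and>
         (\<forall>j. AE t in lebesgue_on {0..T}. D t $ j = f (\<phi> t) t $ j)) \<and>
    (\<forall>j. \<phi> 0 $ j = \<xi> $ j)"

end

theory Submission
  imports Defs
begin

text \<open>
  Write \<open>a = 1 / p\<close>. The right-hand side is taken independent of \<open>x\<close>: its \<open>j\<^sub>0\<close>-th component is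
  \<open>\<gamma> t = (T - t)\<^sup>-\<^sup>a / (1 + ln (T / (T - t)))\<close>, the others vanish, and \<open>\<xi> = 0\<close>. The logarithm puts
  \<open>\<gamma>\<close> in \<open>L\<^sup>p\<close>, but \<open>\<integral>\<^sub>0\<^sup>T (T - s)\<^sup>a\<^sup>-\<^sup>1 \<gamma> s ds\<close> still diverges, so that \<open>J\<^sup>a \<gamma>\<close> blows up at \<open>T\<close>.
  A continuous solution \<open>\<phi>\<close> would satisfy \<open>J\<^sup>1\<^sup>-\<^sup>a \<phi> = J\<^sup>1 \<gamma>\<close> on \<open>[0, T)\<close>: both sides are continuous, hence
  by the lemma of du Bois-Reymond the equality of weak derivatives suffices. Applying \<open>J\<^sup>a\<close> gives
  \<open>J\<^sup>1 \<phi> = J\<^sup>1\<^sup>+\<^sup>a \<gamma>\<close>. The left-hand side is Lipschitz, whereas the difference quotients of the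
  right-hand side are unbounded near \<open>T\<close>.
\<close>

section \<open>Smooth compactly supported test functions\<close>

text \<open>A class of functions closed under differentiation consists of smooth functions. This
  gives all iterated derivatives without computing any of them.\<close>

lemma higher_derivs_differentiable:
  fixes F :: "(real \<Rightarrow> real) set"
  assumes "\<And>f. f \<in> F \<Longrightarrow> \<exists>f'\<in>F. \<forall>x. (f has_real_derivative f' x) (at x)"
    and "f \<in> F"
  shows "(deriv ^^ k) f differentiable (at x)"
proof -
  have closed: "deriv g \<in> F \<and> (\<forall>x. g differentiable (at x))" if "g \<in> F" for g
  proof -
    obtain g' where g': "g' \<in> F" "\<And>x. (g has_real_derivative g' x) (at x)"
      using assms(1)[OF \<open>g \<in> F\<close>] by blast
    then have "deriv g = g'" by (auto intro: DERIV_imp_deriv)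
    with g' show ?thesis using real_differentiable_def by blast
  qed
  have "(deriv ^^ k) f \<in> F"
    by (induction k) (use assms(2) closed in auto)
  with closed show ?thesis by blast
qed

text \<open>The classical smooth function \<open>exp (- 1/y)\<close>, flat at 0. The division by
  \<open>y ^ m\<close> is there because differentiation produces such factors.\<close>

definition flat :: "nat \<Rightarrow> real \<Rightarrow> real"
  where "flat m y = (if y > 0 then exp (- (1 / y)) / y ^ m else 0)"

lemma flat_nonneg: "flat m y \<ge> 0"
  by (simp add: flat_def)

lemma flat_pos: "y > 0 \<Longrightarrow> flat m y > 0"
  by (simp add: flat_def)

text \<open>The single term of index \<open>m + 2\<close> in the series of \<open>exp (1/y)\<close>
  is at most the whole sum, which bounds \<open>flat m y\<close> by a multiple of
  \<open>y^2\<close>; moreover \<open>y \<le> y - z\<close>. The free base point \<open>z\<close>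
  makes the bound usable at every nonpositive point, not just at 0.\<close>

lemma flat_le: "\<bar>flat m y\<bar> \<le> fact (m + 2) * (y - z)\<^sup>2" if "z \<le> 0"
proof (cases "y > 0")
  case True
  define c :: real where "c = fact (m + 2)"
  have "c > 0" by (simp add: c_def)
  have "1 / y ^ (m + 2) \<le> c * exp (1/y)"
  proof -
    have "(\<Sum>n\<in>{m+2}. (1/y) ^ n /\<^sub>R fact n) \<le> exp (1/y)"
      unfolding exp_def using True
      by (intro sum_le_suminf summable_exp_generic) auto
    then have "1 / y ^ (m + 2) / c \<le> exp (1 / y)"
      by (simp add: c_def[symmetric] divide_inverse power_inverse mult.commute
          del: fact_Suc power_Suc add_2_eq_Suc')
    then show ?thesis
      using pos_divide_le_eq[OF \<open>c > 0\<close>] by (simp only: mult.commute)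
  qed
  then have "1 \<le> c * (y ^ (m + 2) * exp (1 / y))"
    using True by (simp add: c_def[symmetric] field_simps del: power_Suc)
  then have "exp (- (1 / y)) / y ^ m \<le> c * y\<^sup>2"
    using True by (simp add: exp_minus field_simps power_add power2_eq_square)
  also have "\<dots> \<le> c * (y - z)\<^sup>2"
    using True that \<open>c > 0\<close> by (intro mult_left_mono power_mono) auto
  finally show ?thesis using True by (simp only: flat_def c_def) simp
qed (simp add: flat_def)

text \<open>For positive \<open>y\<close> this is the quotient rule. For \<open>y \<le> 0\<close>
  the quadratic bound of \<open>flat_le\<close> based at \<open>y\<close> forces the difference
  quotients to 0.\<close>

lemma DERIV_flat: "(flat m has_real_derivative flat (m + 2) y - real m * flat (m + 1) y) (at y)"
proof (cases "y > 0")
  case True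
  have "((\<lambda>y. exp (- (1 / y)) / y ^ m) has_real_derivative flat (m + 2) y - real m * flat (m + 1) y) (at y)"
    by (rule derivative_eq_intros refl | use True in force)+
       (use True in \<open>cases m; simp add: flat_def field_simps power2_eq_square\<close>)
  then show ?thesis
    by (rule has_field_derivative_transform_within_open[where S="{0<..}"])
       (use True in \<open>auto simp: flat_def\<close>)
next
  case False
  have "((\<lambda>z. (flat m z - flat m y) / (z - y)) \<longlongrightarrow> 0) (at y)"
  proof (rule Lim_null_comparison)
    show "\<forall>\<^sub>F z in at y. norm ((flat m z - flat m y) / (z - y)) \<le> fact (m + 2) * \<bar>z - y\<bar>"
    proof (rule eventually_at_topological[THEN iffD2], intro exI[of _ UNIV] conjI ballI impI)
      fix z assume "z \<noteq> y"
      have "\<bar>flat m z\<bar> \<le> fact (m + 2) * \<bar>z - y\<bar> * \<bar>z - y\<bar>"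
        using flat_le[of y m z] False by (simp add: power2_eq_square abs_mult mult.assoc)
      then show "norm ((flat m z - flat m y) / (z - y)) \<le> fact (m + 2) * \<bar>z - y\<bar>"
        using False \<open>z \<noteq> y\<close> by (simp add: flat_def[of m y] field_simps)
    qed auto
    show "((\<lambda>z. fact (m + 2) * \<bar>z - y\<bar>) \<longlongrightarrow> 0) (at y)"
      by (auto intro!: tendsto_eq_intros)
  qed
  then show ?thesis using False by (simp add: has_field_derivative_iff flat_def[of _ y])
qed

text \<open>A class containing the bumps built below and closed under differentiation. Polynomials
  belong to it because the chain rule for \<open>flat m\<close> after \<open>q\<close> brings in the
  constant \<open>- m\<close> and the factor \<open>pderiv q\<close>.\<close>

inductive_set flat_algebra :: "(real \<Rightarrow> real) set" where
  poly: "poly q \<in> flat_algebra"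
| flat: "(\<lambda>x. flat m (poly q x)) \<in> flat_algebra"
| add: "f \<in> flat_algebra \<Longrightarrow> g \<in> flat_algebra \<Longrightarrow> (\<lambda>x. f x + g x) \<in> flat_algebra"
| mult: "f \<in> flat_algebra \<Longrightarrow> g \<in> flat_algebra \<Longrightarrow> (\<lambda>x. f x * g x) \<in> flat_algebra"

lemma flat_algebra_deriv:
  assumes "f \<in> flat_algebra"
  shows "\<exists>f'\<in>flat_algebra. \<forall>x. (f has_real_derivative f' x) (at x)"
  using assms
proof induction
  case (poly q)
  then show ?case using poly_DERIV flat_algebra.poly by blast
next
  case (flat m q)
  let ?f' = "\<lambda>x. (flat (m + 2) (poly q x) + poly [:- real m:] x * flat (m + 1) (poly q x)) * poly (pderiv q) x"
  have "?f' \<in> flat_algebra"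
    by (intro flat_algebra.intros)
  moreover have "\<forall>x. ((\<lambda>x. flat m (poly q x)) has_real_derivative ?f' x) (at x)"
    using DERIV_chain2[OF DERIV_flat poly_DERIV, of m q] by simp
  ultimately show ?case by (intro bexI[of _ ?f'])
next
  case (add f g)
  then obtain f' g' where "f' \<in> flat_algebra" "g' \<in> flat_algebra"
    "\<And>x. (f has_real_derivative f' x) (at x)" "\<And>x. (g has_real_derivative g' x) (at x)" by blast
  then show ?case
    by (intro bexI[of _ "\<lambda>x. f' x + g' x"] allI DERIV_add flat_algebra.intros) auto
next
  case (mult f g)
  then obtain f' g' where "f' \<in> flat_algebra" "g' \<in> flat_algebra"
    "\<And>x. (f has_real_derivative f' x) (at x)" "\<And>x. (g has_real_derivative g' x) (at x)" by blast
  with mult.hyps show ?case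
    by (intro bexI[of _ "\<lambda>x. f' x * g x + g' x * f x"] allI DERIV_mult flat_algebra.intros) auto
qed

text \<open>Membership in the algebra is asked of the derivative, so that \<psi> itself may be a
  primitive with no closed form.\<close>

lemma test_functionI:
  assumes "\<And>x. (\<psi> has_real_derivative \<psi>' x) (at x)" "\<psi>' \<in> flat_algebra"
    and "{x. \<psi> x \<noteq> 0} \<subseteq> {a..b}" "0 < a" "b < T"
  shows "test_function T \<psi>"
  unfolding test_function_def
proof (intro conjI allI)
  fix k x
  have \<psi>: "deriv \<psi> = \<psi>'" using assms(1) by (auto intro: DERIV_imp_deriv)
  show "(deriv ^^ k) \<psi> differentiable (at x)"
  proof (cases k)
    case 0
    then show ?thesis using assms(1) real_differentiable_def by auto
  next
    case (Suc j)
    then show ?thesis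
      using higher_derivs_differentiable[OF flat_algebra_deriv assms(2)]
      by (simp only: \<psi> funpow_Suc_right o_apply)
  qed
  have "closure {x. \<psi> x \<noteq> 0} \<subseteq> {a..b}"
    using assms(3) by (intro closure_minimal) auto
  then show "closure {x. \<psi> x \<noteq> 0} \<subseteq> {0<..<T}"
    using assms(4,5) by auto
qed

text \<open>The test functions \<open>\<psi> t = \<integral>\<^bsub>t-h\<^esub>\<^bsup>t\<^esup> \<rho>\<close> have derivative \<open>\<rho> t - \<rho> (t - h)\<close>.\<close>
lemma test_function_shift_exists:
  fixes T a b h :: real
  assumes "0 < a" "a < b" "0 < h" "b + h < T"
  obtains \<rho> \<psi> where "continuous_on UNIV \<rho>" "\<And>x. \<rho> x \<ge> 0" "\<And>x. x \<in> {a<..<b} \<Longrightarrow> \<rho> x > 0"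
    "\<And>x. x \<notin> {a<..<b} \<Longrightarrow> \<rho> x = 0"
    "test_function T \<psi>" "\<And>x. (\<psi> has_real_derivative \<rho> x - \<rho> (x - h)) (at x)"
proof -
  \<comment> \<open>\<open>q\<close> is \<open>(x - a) * (b - x)\<close>, positive exactly on the
    open interval, and \<open>q'\<close> is its translate by \<open>h\<close>. Hence the translated
    bump is again \<open>flat 0\<close> of a polynomial.\<close>
  define q where "q = [:-(a*b), a+b, -1:]"
  define q' where "q' = [:-((a+h)*(b+h)), a+b+2*h, -1:]"
  define \<rho> where "\<rho> x = flat 0 (poly q x)" for x
  have q: "poly q x = (x - a) * (b - x)" for x by (simp add: q_def algebra_simps)
  have q': "poly q' x = poly q (x - h)" for x by (simp add: q_def q'_def algebra_simps)
  have pos: "poly q x > 0 \<longleftrightarrow> x \<in> {a<..<b}" for x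
    using assms(2) by (auto simp: q zero_less_mult_iff)
  have \<rho>0: "\<rho> x = 0" if "x \<notin> {a<..<b}" for x
    using that pos[of x] by (auto simp: \<rho>_def flat_def)
  have cont: "continuous_on A \<rho>" for A
    unfolding \<rho>_def
    by (intro continuous_at_imp_continuous_on ballI DERIV_isCont[OF DERIV_chain2[OF DERIV_flat poly_DERIV]])
  \<comment> \<open>Starting at \<open>a - 1\<close> puts every \<open>x \<ge> a\<close> in the
    interior of an interval of integration, which yields a two-sided derivative.\<close>
  define R where "R x = integral {a - 1..x} \<rho>" for x
  have R: "(R has_real_derivative \<rho> x) (at x)" for x
  proof (cases "x < a")
    case True
    have "R y = 0" if "y < a" for y
      unfolding R_def using that \<rho>0 by (intro integral_unique has_integral_is_0) auto
    then have "(R has_real_derivative 0) (at x)"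
      using True by (intro has_field_derivative_transform_within_open[OF DERIV_const[of 0], of "{..<a}"]) auto
    then show ?thesis using \<rho>0 True by simp
  next
    case False
    then have "(R has_real_derivative \<rho> x) (at x within {a - 1..x + 1})"
      unfolding R_def by (intro integral_has_real_derivative cont) auto
    then show ?thesis using False by (simp add: at_within_Icc_at)
  qed
  have R0: "R x = R y" if "x \<le> y" "y \<le> a \<or> b \<le> x" for x y
  proof (cases "x = y")
    case False
    then have "x < y" using that by simp
    then obtain z where "z > x" "z < y" "R y - R x = (y - x) * \<rho> z"
      using MVT2[of x y R \<rho>] R by blast
    then show ?thesis using that \<rho>0[of z] by auto
  qed simp
  define \<psi> where "\<psi> x = R x - R (x - h)" for x
  have D: "(\<psi> has_real_derivative \<rho> x - \<rho> (x - h)) (at x)" for x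
  proof -
    have "((\<lambda>x. R (x - h)) has_real_derivative \<rho> (x - h) * 1) (at x)"
      by (rule DERIV_chain2[OF R]) (auto intro!: derivative_eq_intros)
    then show ?thesis unfolding \<psi>_def using R by (auto intro: DERIV_diff)
  qed
  have "(\<lambda>x. flat 0 (poly q x) + poly [:-1:] x * flat 0 (poly q' x)) \<in> flat_algebra"
    by (intro flat_algebra.intros)
  then have "(\<lambda>x. \<rho> x - \<rho> (x - h)) \<in> flat_algebra"
    by (simp add: \<rho>_def q')
  moreover have "{x. \<psi> x \<noteq> 0} \<subseteq> {a..b + h}"
  proof
    fix x assume "x \<in> {x. \<psi> x \<noteq> 0}"
    then have "\<not> (x \<le> a \<or> b \<le> x - h)"
      using R0[of "x - h" x] assms(3) by (auto simp: \<psi>_def)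
    then show "x \<in> {a..b + h}" by simp
  qed
  ultimately have "test_function T \<psi>"
    using test_functionI[OF D] assms by blast
  moreover have "\<rho> x \<ge> 0" "x \<in> {a<..<b} \<Longrightarrow> \<rho> x > 0" for x
    using pos[of x] by (simp_all add: \<rho>_def flat_nonneg flat_pos)
  ultimately show ?thesis
    using cont \<rho>0 D by (intro that)
qed

section \<open>Weak derivatives of continuous functions\<close>

text \<open>The lemma of du Bois-Reymond for continuous \<open>u\<close>. With
  \<open>h = y - x\<close>, a test function with derivative \<open>\<rho> t - \<rho> (t - h)\<close>
  turns the hypothesis into a vanishing integral of \<open>\<rho> t * (u t - u (t + h))\<close>. If
  \<open>u x\<close> and \<open>u y\<close> differed, the second factor would keep one sign near
  \<open>x\<close>, where the bump \<rho> is concentrated.\<close>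

lemma vanishing_weak_deriv_imp_const:
  fixes u :: "real \<Rightarrow> real"
  assumes cont: "continuous_on {0<..<T} u"
    and test: "\<And>\<psi>. test_function T \<psi> \<Longrightarrow> ((\<lambda>t. deriv \<psi> t * u t) has_integral 0) {0..T}"
    and xy: "0 < x" "x < y" "y < T"
  shows "u x = u y"
proof (rule ccontr)
  assume neq: "u x \<noteq> u y"
  define h where "h = y - x"
  have h: "h > 0" using xy by (simp add: h_def)
  \<comment> \<open>The constant factor normalises the sign: \<open>v x\<close> is the square of
    \<open>u x - u y\<close>.\<close>
  define v where "v t = (u t - u (t + h)) * (u x - u y)" for t
  have contv: "continuous_on {0<..<T - h} v"
    unfolding v_def using xy
    by (intro continuous_intros continuous_on_compose2[OF cont]) (auto simp: h_def)
  have "v x > 0"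
    using neq by (simp add: v_def h_def) (metis not_real_square_gt_zero right_minus_eq)
  moreover have "open ({0<..<T - h} \<inter> v -` {0<..})"
    using contv by (intro continuous_open_preimage) auto
  ultimately obtain e where e: "e > 0" "ball x e \<subseteq> {0<..<T - h} \<inter> v -` {0<..}"
    using openE[of "{0<..<T - h} \<inter> v -` {0<..}" x] xy by (auto simp: h_def)
  define b where "b = x + e / 2"
  have b: "x < b" using e by (simp add: b_def)
  have "{x..b} \<subseteq> ball x e" using e by (auto simp: b_def dist_real_def)
  then have pos: "v t > 0" "t > 0" "t + h < T" if "t \<in> {x..b}" for t
    using e(2) that by force+
  obtain \<rho> \<psi> where \<rho>: "continuous_on UNIV \<rho>" "\<And>x. \<rho> x \<ge> 0" "\<And>t. t \<in> {x<..<b} \<Longrightarrow> \<rho> t > 0"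
    "\<And>t. t \<notin> {x<..<b} \<Longrightarrow> \<rho> t = 0"
    and \<psi>: "test_function T \<psi>" "\<And>t. (\<psi> has_real_derivative \<rho> t - \<rho> (t - h)) (at t)"
    using test_function_shift_exists[of x b h T] xy(1) b h pos(3)[of b] by auto
  have cont\<rho>: "continuous_on {x..b} \<rho>" using \<rho>(1) continuous_on_subset by blast
  have "continuous_on {x..b} (\<lambda>t. \<rho> t * u t)" "continuous_on {x..b} (\<lambda>t. \<rho> t * u (t + h))"
    using pos(2,3) h by (intro continuous_intros cont\<rho> continuous_on_compose2[OF cont]; force)+
  then obtain I J where
    I: "((\<lambda>t. \<rho> t * u t) has_integral I) {x..b}" and
    J: "((\<lambda>t. \<rho> t * u (t + h)) has_integral J) {x..b}"
    using integrable_continuous_interval by blast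
  have "((\<lambda>t. \<rho> t * u t) has_integral I) {0..T}"
    by (rule has_integral_on_superset[OF I]) (use \<rho>(4) pos[of b] xy h in auto)
  \<comment> \<open>Translation by \<open>h\<close> makes \<open>J\<close> also the integral of the
    shifted bump against \<open>u\<close>, as it appears in the tested derivative.\<close>
  moreover have "((\<lambda>t. \<rho> (t - h) * u t) has_integral J) {x + h..b + h}"
    using J has_integral_shift_real_ivl_iff[of "\<lambda>t. \<rho> (t - h) * u t" J "x + h" "b + h" h] by simp
  then have "((\<lambda>t. \<rho> (t - h) * u t) has_integral J) {0..T}"
    by (rule has_integral_on_superset) (use \<rho>(4) pos[of b] b xy h in auto)
  moreover have "((\<lambda>t. (\<rho> t - \<rho> (t - h)) * u t) has_integral 0) {0..T}"
    using test[OF \<psi>(1)] DERIV_imp_deriv[OF \<psi>(2)] by simp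
  ultimately have "I - J = 0"
    using has_integral_unique[OF has_integral_diff] by (simp only: left_diff_distrib)
  then have "((\<lambda>t. (\<rho> t * u t - \<rho> t * u (t + h)) * (u x - u y)) has_integral 0) {x..b}"
    using has_integral_mult_left[OF has_integral_diff[OF I J], of "u x - u y"] by simp
  then have int: "((\<lambda>t. \<rho> t * v t) has_integral 0) (cbox x b)"
    by (simp add: v_def algebra_simps)
  have "\<rho> ((x + b) / 2) * v ((x + b) / 2) = 0"
  proof (rule has_integral_0_cbox_imp_0[OF _ _ int])
    show "continuous_on (cbox x b) (\<lambda>t. \<rho> t * v t)"
      using pos(2,3) cont\<rho> by (auto intro!: continuous_intros continuous_on_subset[OF contv])
        (smt (verit) pos(3))+
    show "0 \<le> \<rho> t * v t" if "t \<in> box x b" for t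
      using that \<rho>(2) pos(1)[of t] by (simp add: less_imp_le)
  qed (use b in auto)
  moreover have "\<rho> ((x + b) / 2) > 0" "v ((x + b) / 2) > 0"
    using b by (auto intro!: \<rho>(3) pos(1))
  ultimately show False by simp
qed

text \<open>The primitive \<open>G\<close> of \<open>g\<close> passes the same weak-derivative test
  as \<open>R\<close>, so du Bois-Reymond makes \<open>R - G\<close> constant. Since
  \<open>g\<close> may blow up at \<open>T\<close>, each test function is handled on an interval
  ending strictly before \<open>T\<close>.\<close>

lemma weak_deriv_continuous_has_integral:
  fixes R g d :: "real \<Rightarrow> real"
  assumes "has_weak_deriv T R d" "AE t in lebesgue_on {0..T}. d t = g t"
    and contR: "continuous_on {0..T} R" and contg: "continuous_on {0..<T} g"
    and t: "t \<in> {0..<T}"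
  shows "(g has_integral R t - R 0) {0..t}"
proof -
  define G where "G t = integral {0..t} g" for t
  define u where "u t = R t - G t" for t
  have contg': "continuous_on {0..b} g" if "b < T" for b
    using that by (intro continuous_on_subset[OF contg]) auto
  have G: "(G has_real_derivative g x) (at x within {0..b})" if "x \<in> {0..b}" "b < T" for x b
    unfolding G_def using integral_has_real_derivative[OF contg'] that by blast
  have G': "(G has_real_derivative g x) (at x)" if "x \<in> {0<..<T}" for x
    using G[of x "(x + T) / 2"] that by (simp add: at_within_Icc_at)
  have contG: "continuous_on {0..b} G" if "b < T" for b
    using G[OF _ that] by (intro DERIV_continuous_on)
  have contu: "continuous_on {0..b} u" if "b < T" for b
    unfolding u_def using that by (intro continuous_intros contG continuous_on_subset[OF contR]) auto
  have const: "u x = u y" if "0 < x" "x < y" "y < T" for x y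
  proof (rule vanishing_weak_deriv_imp_const[OF _ _ that])
    show "continuous_on {0<..<T} u"
      unfolding u_def using DERIV_isCont[OF G']
      by (intro continuous_intros continuous_on_subset[OF contR] continuous_at_imp_continuous_on) auto
    fix \<psi> assume \<psi>: "test_function T \<psi>"
    have diff: "\<psi> differentiable (at x)" "deriv \<psi> differentiable (at x)" for x
      using \<psi> unfolding test_function_def by (metis funpow_0, metis funpow_0 funpow_simps_right(2) comp_apply)
    then have D\<psi>: "(\<psi> has_real_derivative deriv \<psi> x) (at x)" for x
      by (simp add: DERIV_deriv_iff_real_differentiable)
    have cont: "continuous_on A \<psi>" "continuous_on A (deriv \<psi>)" for A
      using diff by (auto intro!: continuous_at_imp_continuous_on differentiable_imp_continuous_within)
    define S where "S = closure {x. \<psi> x \<noteq> 0}"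
    have S: "S \<subseteq> {0<..<T}"
      using \<psi> by (simp add: S_def test_function_def)
    then have "S \<subseteq> {0..T}" by auto
    then have "compact S"
      using bounded_subset[OF bounded_closed_interval[of 0 T], of S]
      by (simp add: S_def compact_eq_bounded_closed)
    \<comment> \<open>The support is compact in the open interval, so a cut \<open>b < T\<close> can
      be placed to its right; on the interval up to \<open>b\<close> the function \<open>g\<close>
      is continuous and \<open>G\<close> is its classical primitive.\<close>
    obtain b where b: "0 < b" "b < T" "S \<subseteq> {0..<b}"
    proof (cases "S = {}")
      case True
      then show ?thesis using that[of "T / 2"] \<open>0 < x\<close> \<open>x < y\<close> \<open>y < T\<close> by auto
    next
      case False
      then obtain m where "m \<in> S" "\<forall>s\<in>S. s \<le> m"
        using compact_attains_sup[OF \<open>compact S\<close>] by blast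
      then show ?thesis using S that[of "(m + T) / 2"] by fastforce
    qed
    have \<psi>0: "\<psi> x = 0" if "x \<notin> {0<..<b}" for x
      using that S b(3) closure_subset[of "{x. \<psi> x \<noteq> 0}"] by (fastforce simp: S_def)
    have D0: "deriv \<psi> x = 0" if "x \<notin> {0..b}" for x
    proof (rule DERIV_imp_deriv)
      show "(\<psi> has_real_derivative 0) (at x)"
        by (rule has_field_derivative_transform_within_open[OF DERIV_const[of 0], of "- {0..b}"])
           (use \<psi>0 that in auto)
    qed
    \<comment> \<open>Integration by parts; both boundary terms vanish with \<psi>.\<close>
    have "((\<lambda>x. deriv \<psi> x * G x + g x * \<psi> x) has_integral \<psi> b * G b - \<psi> 0 * G 0) {0..b}"
      by (rule fundamental_theorem_of_calculus)
         (use b in \<open>auto intro!: DERIV_mult D\<psi>[THEN has_field_derivative_at_within] G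
             simp flip: has_real_derivative_iff_has_vector_derivative\<close>)
    then have "((\<lambda>x. deriv \<psi> x * G x + g x * \<psi> x) has_integral 0) {0..b}"
      using \<psi>0[of 0] \<psi>0[of b] by simp
    then have part: "((\<lambda>x. deriv \<psi> x * G x + g x * \<psi> x) has_integral 0) {0..T}"
      by (rule has_integral_on_superset) (use \<psi>0 D0 b in auto)
    \<comment> \<open>Because \<psi> vanishes from \<open>b\<close> on, the product with
      \<open>g\<close> is continuous up to \<open>T\<close> whatever \<open>g\<close> does
      there.\<close>
    have "continuous_on {0..T} (\<lambda>x. if x \<le> b then \<psi> x * g x else 0)"
      using \<psi>0 b by (intro continuous_on_cases_1 continuous_intros cont continuous_on_subset[OF contg]) auto
    then have "continuous_on {0..T} (\<lambda>x. \<psi> x * g x)"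
      by (rule continuous_on_eq) (use \<psi>0 in auto)
    then have int\<psi>g: "integrable (lebesgue_on {0..T}) (\<lambda>x. \<psi> x * g x)"
      by (rule continuous_imp_integrable_real)
    then have \<psi>g: "((\<lambda>x. \<psi> x * g x) has_integral (\<integral>x. \<psi> x * g x \<partial>lebesgue_on {0..T})) {0..T}"
      by (rule has_integral_integral_lebesgue_on) simp
    have "(\<integral>x. deriv \<psi> x * R x \<partial>lebesgue_on {0..T}) = - (\<integral>x. \<psi> x * d x \<partial>lebesgue_on {0..T})"
      using assms(1) \<psi> by (simp add: has_weak_deriv_def)
    also have "(\<integral>x. \<psi> x * d x \<partial>lebesgue_on {0..T}) = (\<integral>x. \<psi> x * g x \<partial>lebesgue_on {0..T})"
    proof (rule integral_cong_AE)
      have "\<psi> \<in> borel_measurable (lebesgue_on {0..T})" "d \<in> borel_measurable (lebesgue_on {0..T})"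
        using cont assms(1) continuous_imp_measurable_on_sets_lebesgue[of "{0..T}"]
        by (auto simp: has_weak_deriv_def)
      then show "(\<lambda>x. \<psi> x * d x) \<in> borel_measurable (lebesgue_on {0..T})" by measurable
      show "(\<lambda>x. \<psi> x * g x) \<in> borel_measurable (lebesgue_on {0..T})"
        using int\<psi>g by blast
      show "AE x in lebesgue_on {0..T}. \<psi> x * d x = \<psi> x * g x"
        using assms(2) by eventually_elim simp
    qed
    finally have "((\<lambda>x. deriv \<psi> x * R x) has_integral - (\<integral>x. \<psi> x * g x \<partial>lebesgue_on {0..T})) {0..T}"
      using has_integral_integral_lebesgue_on[of "{0..T}" "\<lambda>x. deriv \<psi> x * R x"]
        continuous_imp_integrable_real[OF continuous_on_mult[OF cont(2) contR]] by simp
    \<comment> \<open>The terms with \<open>\<psi> * g\<close> cancel, leaving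
      \<open>deriv \<psi>\<close> times \<open>R - G\<close>.\<close>
    from has_integral_diff[OF has_integral_add[OF this \<psi>g] part]
    show "((\<lambda>t. deriv \<psi> t * u t) has_integral 0) {0..T}"
      by (simp add: u_def algebra_simps)
  qed
  \<comment> \<open>Du Bois-Reymond speaks of the open interval only; continuity carries the
    constant value to the endpoint 0.\<close>
  have "u t = u 0"
  proof -
    define b where "b = (t + T) / 2"
    have b: "t < b" "b < T" "0 < b" using t by (auto simp: b_def)
    have cl: "closure {0<..<b} = {0..b}" using b by simp
    define c where "c = b / 2"
    have c: "0 < c" "c < T" using b by (auto simp: c_def)
    have uc: "u x = u c" if "x \<in> {0<..<b}" for x
    proof (cases x c rule: linorder_cases)
      case less
      then show ?thesis using that c by (intro const) auto
    next
      case greater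
      then show ?thesis using that b c by (intro const[symmetric]) auto
    qed simp
    have "continuous_on (closure {0<..<b}) u"
      using contu[OF b(2)] by (simp only: cl)
    then have "u x = u c" if "x \<in> {0..b}" for x
      by (rule continuous_constant_on_closure) (use uc that in \<open>simp_all only: cl\<close>)
    from this[of t] this[of 0] show ?thesis using t b by simp
  qed
  then have "R t - R 0 = integral {0..t} g"
    by (simp add: u_def G_def)
  then show ?thesis
    using t integrable_integral[OF integrable_continuous_interval[OF contg'[of t]]] by simp
qed

section \<open>Convolution of power kernels\<close>

text \<open>Values in \<open>ennreal\<close> let Tonelli's theorem apply with measurability alone,
  so convolutions can be reassociated before anything is known to be finite.\<close>

definition nn_conv :: "(real \<Rightarrow> ennreal) \<Rightarrow> (real \<Rightarrow> ennreal) \<Rightarrow> real \<Rightarrow> ennreal"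
  where "nn_conv f g t = (\<integral>\<^sup>+s. f (t - s) * g s \<partial>lborel)"

lemma borel_measurable_nn_conv [measurable]:
  assumes [measurable]: "f \<in> borel_measurable borel" "g \<in> borel_measurable borel"
  shows "nn_conv f g \<in> borel_measurable borel"
  unfolding nn_conv_def by measurable

text \<open>Tonelli's theorem, followed by the translation of \<open>s\<close> by \<open>r\<close>
  in the inner integral.\<close>

lemma nn_conv_assoc:
  assumes [measurable]: "f \<in> borel_measurable borel" "g \<in> borel_measurable borel"
    "h \<in> borel_measurable borel"
  shows "nn_conv f (nn_conv g h) t = nn_conv (nn_conv f g) h t"
proof -
  have "nn_conv f (nn_conv g h) t = (\<integral>\<^sup>+s. \<integral>\<^sup>+r. f (t - s) * (g (s - r) * h r) \<partial>lborel \<partial>lborel)"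
    by (simp add: nn_conv_def nn_integral_cmult)
  also have "\<dots> = (\<integral>\<^sup>+r. \<integral>\<^sup>+s. f (t - s) * (g (s - r) * h r) \<partial>lborel \<partial>lborel)"
    by (rule lborel_pair.Fubini') measurable
  also have "\<dots> = (\<integral>\<^sup>+r. nn_conv f g (t - r) * h r \<partial>lborel)"
  proof (rule nn_integral_cong)
    fix r
    have "(\<integral>\<^sup>+s. f (t - s) * (g (s - r) * h r) \<partial>lborel) = (\<integral>\<^sup>+s. f (t - s) * g (s - r) \<partial>lborel) * h r"
      by (simp add: nn_integral_multc flip: mult.assoc)
    also have "(\<integral>\<^sup>+s. f (t - s) * g (s - r) \<partial>lborel) = nn_conv f g (t - r)"
      unfolding nn_conv_def
      by (subst nn_integral_real_affine[of _ 1 r]) (auto simp: algebra_simps)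
    finally show "(\<integral>\<^sup>+s. f (t - s) * (g (s - r) * h r) \<partial>lborel) = nn_conv f g (t - r) * h r" .
  qed
  finally show ?thesis by (simp add: nn_conv_def)
qed

lemma nn_conv_add:
  assumes [measurable]: "f \<in> borel_measurable borel" "g \<in> borel_measurable borel"
    "h \<in> borel_measurable borel"
  shows "nn_conv f (\<lambda>s. g s + h s) t = nn_conv f g t + nn_conv f h t"
  by (simp add: nn_conv_def distrib_left nn_integral_add)

lemma nn_conv_cmult:
  assumes [measurable]: "f \<in> borel_measurable borel" "g \<in> borel_measurable borel"
  shows "nn_conv f (\<lambda>s. c * g s) t = c * nn_conv f g t"
    and "nn_conv (\<lambda>s. c * f s) g t = c * nn_conv f g t"
  by (simp_all add: nn_conv_def nn_integral_cmult mult.left_commute mult.assoc)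

text \<open>Up to the factor \<open>1 / \<Gamma>(a)\<close>, convolution with this kernel is the Riemann--Liouville
  integral of order \<open>a\<close>.\<close>
definition pow_kernel :: "real \<Rightarrow> real \<Rightarrow> ennreal"
  where "pow_kernel a t = ennreal (indicator {0<..} t * t powr (a - 1))"

lemma borel_measurable_pow_kernel [measurable]: "pow_kernel a \<in> borel_measurable borel"
  unfolding pow_kernel_def by measurable

lemma pow_kernel_nonpos [simp]: "t \<le> 0 \<Longrightarrow> pow_kernel a t = 0"
  by (simp add: pow_kernel_def)

lemma pow_kernel_pos [simp]: "t > 0 \<Longrightarrow> pow_kernel a t = ennreal (t powr (a - 1))"
  by (simp add: pow_kernel_def)

text \<open>The semigroup law of fractional integration. For \<open>t > 0\<close> the substitution
  of \<open>t * x\<close> for \<open>s\<close> leaves a Beta integral; for \<open>t \<le> 0\<close>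
  the two kernels are never positive together.\<close>

lemma nn_conv_pow_kernel:
  assumes "a > 0" "b > 0"
  shows "nn_conv (pow_kernel a) (pow_kernel b) = (\<lambda>t. ennreal (Beta a b) * pow_kernel (a + b) t)"
proof
  fix t
  show "nn_conv (pow_kernel a) (pow_kernel b) t = ennreal (Beta a b) * pow_kernel (a + b) t"
  proof (cases "t > 0")
    case False
    have "(\<lambda>s. pow_kernel a (t - s) * pow_kernel b s) = (\<lambda>_. 0)"
      using False by (auto simp: fun_eq_iff pow_kernel_def indicator_def)
    then show ?thesis using False by (simp add: nn_conv_def)
  next
    case True
    have "nn_conv (pow_kernel a) (pow_kernel b) t
      = ennreal t * (\<integral>\<^sup>+x. pow_kernel a (t - t * x) * pow_kernel b (t * x) \<partial>lborel)"
      unfolding nn_conv_def using True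
      by (subst nn_integral_real_affine[of _ t 0]) auto
    also have "(\<lambda>x. pow_kernel a (t - t * x) * pow_kernel b (t * x)) =
       (\<lambda>x. ennreal (t powr (a + b - 2)) * (ennreal (x powr (b - 1) * (1 - x) powr (a - 1)) * indicator {0..1} x))"
    proof
      fix x :: real
      \<comment> \<open>The endpoints 0 and 1 cause no mismatch with the closed indicator, since
        \<open>powr\<close> with base 0 is 0.\<close>
      consider "x \<le> 0" | "x \<ge> 1" | "0 < x" "x < 1" by linarith
      then show "pow_kernel a (t - t * x) * pow_kernel b (t * x) =
         ennreal (t powr (a + b - 2)) * (ennreal (x powr (b - 1) * (1 - x) powr (a - 1)) * indicator {0..1} x)"
      proof cases
        case 1
        then have "t * x \<le> 0" using True by (simp add: mult_nonneg_nonpos)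
        then show ?thesis using 1 by (cases "x = 0") auto
      next
        case 2
        then have "t - t * x \<le> 0" using True by simp
        then show ?thesis using 2 by (cases "x = 1") auto
      next
        case 3
        then have "t - t * x = t * (1 - x)" "t * x > 0" "t * (1 - x) > 0"
          using True by (auto simp: algebra_simps)
        then show ?thesis using 3 True
          by (simp add: powr_mult flip: ennreal_mult)
             (simp add: powr_add[symmetric] mult_ac flip: mult.assoc powr_add)
      qed
    qed
    also have "(\<integral>\<^sup>+x. ennreal (t powr (a + b - 2)) * (ennreal (x powr (b - 1) * (1 - x) powr (a - 1)) * indicator {0..1} x) \<partial>lborel)
        = ennreal (t powr (a + b - 2)) * ennreal (Beta b a)"
      using nn_integral_has_integral_lebesgue'[OF _ has_integral_Beta_real[OF assms(2,1)]]
      by (subst nn_integral_cmult) auto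
    also have "ennreal t * (ennreal (t powr (a + b - 2)) * ennreal (Beta b a))
        = ennreal (Beta a b) * ennreal (t * t powr (a + b - 2))"
      using True by (simp add: Beta_commute[of b a] ennreal_mult mult_ac)
    also have "t * t powr (a + b - 2) = t powr (a + b - 1)"
      using True powr_add[of t 1 "a + b - 2"] by (simp add: algebra_simps)
    finally show ?thesis using True by simp
  qed
qed

section \<open>The critical weight\<close>

text \<open>The value 0 outside the half-open interval gives a nonnegative Borel function on the
  whole line, ready for \<open>nn_conv\<close>. The summand 1 keeps the denominator positive at
  \<open>s = 0\<close>.\<close>

definition critical_weight :: "real \<Rightarrow> real \<Rightarrow> real \<Rightarrow> real"
  where "critical_weight T a s =
    (if s \<in> {0..<T} then (T - s) powr (- a) / (1 + ln (T / (T - s))) else 0)"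

lemma borel_measurable_critical_weight [measurable]: "critical_weight T a \<in> borel_measurable borel"
  unfolding critical_weight_def by measurable

lemma log_factor_pos: "s \<in> {0..<T} \<Longrightarrow> 1 + ln (T / (T - s)) > (0::real)"
  by (auto simp: field_simps intro!: add_pos_nonneg)

lemma critical_weight_nonneg: "critical_weight T a s \<ge> 0"
  using log_factor_pos[of s T] by (auto simp: critical_weight_def)

lemma continuous_on_critical_weight: "continuous_on {0..<T} (critical_weight T a)"
proof -
  have "continuous_on {0..<T} (\<lambda>s. (T - s) powr (- a) / (1 + ln (T / (T - s))))"
    using log_factor_pos[of _ T, THEN less_imp_neq] by (intro continuous_intros) force+
  then show ?thesis
    by (rule continuous_on_eq) (simp add: critical_weight_def)
qed

lemma DERIV_log_factor:
  "s \<in> {0..<T} \<Longrightarrow> ((\<lambda>s. 1 + ln (T / (T - s))) has_real_derivative 1 / (T - s)) (at s)"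
  by (rule derivative_eq_intros refl | simp add: divide_simps)+

text \<open>With \<open>L = 1 + ln (T / (T - s))\<close>, the power is
  \<open>L powr (- p) / (T - s)\<close>, and \<open>1 / (T - s)\<close> is the derivative of
  \<open>L\<close>. The primitive \<open>- L powr (1 - p) / (p - 1)\<close> tends to 0 at
  \<open>T\<close> because \<open>p > 1\<close>, so it extends continuously and the fundamental
  theorem applies up to \<open>T\<close>.\<close>

lemma critical_weight_powr_integrable:
  assumes "T > 0" "p > 1"
  shows "integrable (lebesgue_on {0..T}) (\<lambda>t. norm (critical_weight T (1 / p) t) powr p)"
proof -
  define F where "F s = (if s < T then - ((1 + ln (T / (T - s))) powr (1 - p) / (p - 1)) else 0)" for s
  have deriv: "(F has_real_derivative norm (critical_weight T (1 / p) s) powr p) (at s)"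
    if "s \<in> {0..<T}" for s
  proof -
    have L: "1 + ln (T / (T - s)) > 0" by (rule log_factor_pos[OF that])
    have "((\<lambda>s. - ((1 + ln (T / (T - s))) powr (1 - p) / (p - 1))) has_real_derivative
        - ((1 - p) * (1 + ln (T / (T - s))) powr (1 - p - of_nat 1) * (1 / (T - s)) / (p - 1))) (at s)"
      by (intro DERIV_minus DERIV_cdivide DERIV_fun_powr DERIV_log_factor that L)
    also have "- ((1 - p) * (1 + ln (T / (T - s))) powr (1 - p - of_nat 1) * (1 / (T - s)) / (p - 1))
      = (1 + ln (T / (T - s))) powr (- p) / (T - s)"
    proof -
      have "- ((1 - p) * x * (1 / d) / (p - 1)) = x / d" for x d
        using assms(2) by (cases "d = 0") (auto simp: field_simps)
      then show ?thesis by simp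
    qed
    also have "\<dots> = norm (critical_weight T (1 / p) s) powr p"
    proof -
      have "norm (critical_weight T (1 / p) s) = (T - s) powr (- (1 / p)) / (1 + ln (T / (T - s)))"
        using critical_weight_nonneg[of T "1 / p" s] that by (simp add: critical_weight_def)
      then show ?thesis
        using L that assms(2) by (simp add: powr_divide powr_mult powr_powr powr_minus_divide)
    qed
    finally have "((\<lambda>s. - ((1 + ln (T / (T - s))) powr (1 - p) / (p - 1))) has_real_derivative
        norm (critical_weight T (1 / p) s) powr p) (at s)" .
    then show ?thesis
      by (rule has_field_derivative_transform_within_open[of _ _ _ "{..<T}"])
         (use that in \<open>auto simp: F_def\<close>)
  qed
  have "filterlim (\<lambda>s. T - s) (at_right 0) (at_left T)"
    unfolding filterlim_at
    by (auto intro!: tendsto_eq_intros simp: eventually_at_filter)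
  then have "filterlim (\<lambda>s. T * inverse (T - s)) at_top (at_left T)"
    by (intro filterlim_tendsto_pos_mult_at_top[OF tendsto_const assms(1)]
        filterlim_compose[OF filterlim_inverse_at_top_right])
  then have "filterlim (\<lambda>s. 1 + ln (T / (T - s))) at_top (at_left T)"
    unfolding divide_inverse
    by (intro filterlim_tendsto_add_at_top[OF tendsto_const] filterlim_compose[OF ln_at_top])
  then have "((\<lambda>s. - ((1 + ln (T / (T - s))) powr (1 - p) / (p - 1))) \<longlongrightarrow> - (0 / (p - 1))) (at_left T)"
    using assms(2) by (intro tendsto_intros tendsto_neg_powr) auto
  then have "((\<lambda>s. - ((1 + ln (T / (T - s))) powr (1 - p) / (p - 1))) \<longlongrightarrow> 0) (at_left T)"
    by simp
  then have lim: "(F \<longlongrightarrow> 0) (at_left T)"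
    by (rule Lim_transform_eventually) (auto simp: F_def eventually_at_filter)
  have "continuous_on {0..T} F"
  proof (rule continuous_on_eq_continuous_within[THEN iffD2], rule ballI)
    fix s assume s: "s \<in> {0..T}"
    show "continuous (at s within {0..T}) F"
    proof (cases "s = T")
      case True
      then show ?thesis
        using lim assms(1) by (simp add: continuous_within at_within_Icc_at_left F_def)
    next
      case False
      then show ?thesis
        using s by (auto intro!: continuous_at_imp_continuous_at_within[OF DERIV_isCont[OF deriv]])
    qed
  qed
  then have "((\<lambda>t. norm (critical_weight T (1 / p) t) powr p) has_integral F T - F 0) {0..T}"
    using assms(1) deriv
    by (intro fundamental_theorem_of_calculus_interior)
       (auto simp flip: has_real_derivative_iff_has_vector_derivative)
  then have "(\<lambda>t. norm (critical_weight T (1 / p) t) powr p) absolutely_integrable_on {0..T}"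
    by (intro nonnegative_absolutely_integrable_1) (auto simp: integrable_on_def)
  then show ?thesis
    by (simp add: set_integrable_def integrable_restrict_space)
qed

lemma critical_weight_in_Lp:
  assumes "T > 0" "p > 1"
  shows "in_Lp p T (critical_weight T (1 / p))"
  using critical_weight_powr_integrable[OF assms]
  by (simp add: in_Lp_def) (simp add: measurable_restrict_space1 measurable_completion)

text \<open>The powers multiply to \<open>1 / (T - s)\<close>, so the integrand is the derivative of
  \<open>ln L\<close> with \<open>L = 1 + ln (T / (T - s))\<close>. The result is unbounded as
  \<open>t\<close> approaches \<open>T\<close>: this is the divergence on which nonexistence
  rests.\<close>

lemma nn_integral_critical_weight:
  assumes "t \<in> {0..<T}"
  shows "(\<integral>\<^sup>+s. ennreal ((T - s) powr (a - 1) * critical_weight T a s) * indicator {0..t} s \<partial>lborel)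
    = ennreal (ln (1 + ln (T / (T - t))))"
proof (rule nn_integral_has_integral_lebesgue')
  have "((\<lambda>s. (T - s) powr (a - 1) * critical_weight T a s) has_integral
      ln (1 + ln (T / (T - t))) - ln (1 + ln (T / (T - 0)))) {0..t}"
  proof (rule fundamental_theorem_of_calculus)
    fix s assume s: "s \<in> {0..t}"
    then have L: "1 + ln (T / (T - s)) > 0" using assms by (intro log_factor_pos) auto
    have "((\<lambda>s. ln (1 + ln (T / (T - s)))) has_real_derivative
        1 / (1 + ln (T / (T - s))) * (1 / (T - s))) (at s)"
      using s assms L by (intro DERIV_chain2[OF DERIV_ln_divide DERIV_log_factor]) auto
    moreover have "(T - s) powr (a - 1) * (T - s) powr (- a) = 1 / (T - s)"
      using s assms powr_minus_divide[of "T - s" 1] by (simp flip: powr_add)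
    then have "1 / (1 + ln (T / (T - s))) * (1 / (T - s)) = (T - s) powr (a - 1) * critical_weight T a s"
      using s assms by (simp add: critical_weight_def)
    ultimately show "((\<lambda>s. ln (1 + ln (T / (T - s)))) has_vector_derivative
        (T - s) powr (a - 1) * critical_weight T a s) (at s within {0..t})"
      by (simp add: has_real_derivative_iff_has_vector_derivative has_vector_derivative_at_within)
  qed (use assms in auto)
  then show "((\<lambda>s. (T - s) powr (a - 1) * critical_weight T a s) has_integral
      ln (1 + ln (T / (T - t)))) {0..t}"
    using assms by (cases "T = 0") auto
qed (simp add: critical_weight_nonneg)

section \<open>Riemann--Liouville integrals\<close>

lemma nn_conv_pow_kernel_cong:
  assumes "\<And>s. s < t \<Longrightarrow> f s = g s"
  shows "nn_conv (pow_kernel a) f t = nn_conv (pow_kernel a) g t"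
  unfolding nn_conv_def
proof (rule nn_integral_cong)
  fix s
  show "pow_kernel a (t - s) * f s = pow_kernel a (t - s) * g s"
    using assms[of s] by (cases "s < t") auto
qed

lemma nn_conv_pow_kernel_nonpos:
  assumes "\<And>s. s < 0 \<Longrightarrow> g s = 0" "t \<le> 0"
  shows "nn_conv (pow_kernel a) g t = 0"
proof -
  have "nn_conv (pow_kernel a) g t = nn_conv (pow_kernel a) (\<lambda>_. 0) t"
    using assms by (intro nn_conv_pow_kernel_cong) auto
  then show ?thesis by (simp add: nn_conv_def)
qed

text \<open>Domination by \<open>M\<close> times the convolution integrand for
  \<open>pow_kernel 1\<close>, the indicator of the positive half-line, whose integral the Beta
  formula shows to be finite.\<close>

lemma pow_kernel_convolution_integrable:
  fixes w :: "real \<Rightarrow> real"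
  assumes "b > 0" and [measurable]: "w \<in> borel_measurable borel" and w: "\<And>s. \<bar>w s\<bar> \<le> M"
  shows "integrable lborel (\<lambda>s. enn2real (pow_kernel b (t - s)) * (indicator {0<..} s * w s))"
proof -
  have "integrable lborel (\<lambda>s. enn2real (pow_kernel b (t - s)) * indicator {0<..} s)"
  proof (rule integrableI_nonneg)
    have "(\<integral>\<^sup>+s. ennreal (enn2real (pow_kernel b (t - s)) * indicator {0<..} s) \<partial>lborel)
       = nn_conv (pow_kernel b) (pow_kernel 1) t"
      unfolding nn_conv_def
      by (intro nn_integral_cong) (auto simp: pow_kernel_def indicator_def)
    also have "\<dots> < \<infinity>"
      using assms(1) by (simp add: nn_conv_pow_kernel pow_kernel_def ennreal_mult_less_top)
    finally show "(\<integral>\<^sup>+s. ennreal (enn2real (pow_kernel b (t - s)) * indicator {0<..} s) \<partial>lborel) < \<infinity>" .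
  qed auto
  then have "integrable lborel (\<lambda>s. M * (enn2real (pow_kernel b (t - s)) * indicator {0<..} s))"
    by simp
  then show ?thesis
  proof (rule Bochner_Integration.integrable_bound)
    show "AE s in lborel. norm (enn2real (pow_kernel b (t - s)) * (indicator {0<..} s * w s))
        \<le> norm (M * (enn2real (pow_kernel b (t - s)) * indicator {0<..} s))"
    proof (rule AE_I2)
      fix s
      have "\<bar>w s\<bar> \<le> \<bar>M\<bar>" using w[of s] by simp
      then show "norm (enn2real (pow_kernel b (t - s)) * (indicator {0<..} s * w s))
        \<le> norm (M * (enn2real (pow_kernel b (t - s)) * indicator {0<..} s))"
        by (simp add: abs_mult mult_right_mono mult.commute[of _ "\<bar>w s\<bar>"] flip: mult.assoc)
    qed
  qed measurable
qed

text \<open>The bridge from the Lebesgue integral over a varying interval to a convolution on the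
  line; \<open>w\<close> is a Borel stand-in for \<open>g\<close>.\<close>

lemma RL_integral_eq_convolution:
  fixes g w :: "real \<Rightarrow> real"
  assumes [measurable]: "w \<in> borel_measurable borel" and gw: "\<And>s. s \<in> {0..t} \<Longrightarrow> g s = w s" and "g 0 = 0"
  shows "RL_integral b g t
    = (1 / Gamma b) * (\<integral>s. enn2real (pow_kernel b (t - s)) * (indicator {0<..} s * w s) \<partial>lborel)"
proof -
  have "(\<integral>s. (t - s) powr (b - 1) *\<^sub>R g s \<partial>lebesgue_on {0..t})
     = (\<integral>s. indicator {0..t} s *\<^sub>R ((t - s) powr (b - 1) *\<^sub>R g s) \<partial>lebesgue)"
    by (intro integral_restrict_space) simp
  also have "(\<lambda>s. indicator {0..t} s *\<^sub>R ((t - s) powr (b - 1) *\<^sub>R g s))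
     = (\<lambda>s. enn2real (pow_kernel b (t - s)) * (indicator {0<..} s * w s))"
  proof
    fix s
    \<comment> \<open>At \<open>s = 0\<close> equality comes from \<open>g 0 = 0\<close>; at
      \<open>s = t\<close> both kernels are 0, again since \<open>powr\<close> with base 0 is
      0.\<close>
    consider "s < 0" | "s = 0" | "s = t" | "s > t" | "0 < s" "s < t" by linarith
    then show "indicator {0..t} s *\<^sub>R ((t - s) powr (b - 1) *\<^sub>R g s)
      = enn2real (pow_kernel b (t - s)) * (indicator {0<..} s * w s)"
      by cases (auto simp: gw assms(3))
  qed
  also have "(\<integral>s. enn2real (pow_kernel b (t - s)) * (indicator {0<..} s * w s) \<partial>lebesgue)
     = (\<integral>s. enn2real (pow_kernel b (t - s)) * (indicator {0<..} s * w s) \<partial>lborel)"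
    by (rule integral_completion) measurable
  finally show ?thesis by (simp add: RL_integral_def)
qed

text \<open>Substituting \<open>r = t - s\<close> moves the dependence on \<open>t\<close> from the
  singular kernel to the continuous factor, after which dominated convergence applies.\<close>

lemma continuous_on_RL_integral:
  fixes g :: "real \<Rightarrow> real"
  assumes "b > 0" "T > 0" and g: "continuous_on {0..T} g" "g 0 = 0"
  shows "continuous_on {0..T} (RL_integral b g)"
proof -
  \<comment> \<open>Constant extension of \<open>g\<close> beyond both endpoints. As
    \<open>g 0 = 0\<close>, it vanishes on the negative half-line and absorbs the cutoff at
    0.\<close>
  define w where "w s = g (max 0 (min T s))" for s
  have w: "continuous_on UNIV w"
    unfolding w_def using assms(2)
    by (intro continuous_on_compose2[OF g(1)] continuous_intros) auto
  then have w_borel [measurable]: "w \<in> borel_measurable borel"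
    by (rule borel_measurable_continuous_onI)
  obtain M where M: "\<forall>s\<in>{0..T}. \<bar>g s\<bar> \<le> M"
    using compact_imp_bounded[OF compact_continuous_image[OF g(1) compact_Icc]]
    by (auto simp: bounded_iff)
  define K where "K r = enn2real (pow_kernel b r)" for r
  have [measurable]: "K \<in> borel_measurable borel" unfolding K_def by measurable
  have w0: "w s = 0" if "s \<le> 0" for s
    using that g(2) by (simp add: w_def)
  have intK: "integrable lborel (\<lambda>r. M * (K r * indicator {..<T} r))"
  proof -
    have "integrable lborel (\<lambda>s. K (T - s) * (indicator {0<..} s * 1))"
      unfolding K_def by (rule pow_kernel_convolution_integrable[of _ _ 1]) (use assms in auto)
    from lborel_integrable_real_affine[OF this, of "-1" T]
    have "integrable lborel (\<lambda>r. K r * indicator {..<T} r)"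
      by (simp add: indicator_def)
    then show ?thesis by simp
  qed
  have eq: "RL_integral b g t = (1 / Gamma b) * (\<integral>r. K r * w (t - r) \<partial>lborel)" if "t \<in> {0..T}" for t
  proof -
    have "RL_integral b g t = (1 / Gamma b) * (\<integral>s. K (t - s) * (indicator {0<..} s * w s) \<partial>lborel)"
      unfolding K_def by (intro RL_integral_eq_convolution w_borel) (use that g(2) in \<open>simp_all add: w_def[of s for s]\<close>)
    also have "(\<lambda>s. K (t - s) * (indicator {0<..} s * w s)) = (\<lambda>s. K (t - s) * w s)"
      using w0 by (auto simp: indicator_def fun_eq_iff)
    also have "(\<integral>s. K (t - s) * w s \<partial>lborel) = (\<integral>r. K r * w (t - r) \<partial>lborel)"
      by (subst lborel_integral_real_affine[of "-1" _ t]) simp_all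
    finally show ?thesis .
  qed
  have "continuous_on {0..T} (\<lambda>t. (1 / Gamma b) * (\<integral>r. K r * w (t - r) \<partial>lborel))"
  proof (intro continuous_intros continuous_on_sequentiallyI)
    fix u a assume u: "\<forall>n. u n \<in> {0..T}" "a \<in> {0..T}" "u \<longlonglongrightarrow> a"
    show "(\<lambda>n. \<integral>r. K r * w (u n - r) \<partial>lborel) \<longlonglongrightarrow> (\<integral>r. K r * w (a - r) \<partial>lborel)"
    proof (rule integral_dominated_convergence[OF _ _ intK])
      show "AE r in lborel. (\<lambda>n. K r * w (u n - r)) \<longlonglongrightarrow> K r * w (a - r)"
        using w u(3) by (intro AE_I2 tendsto_intros continuous_on_tendsto_compose[OF w]) auto
      fix n
      show "AE r in lborel. norm (K r * w (u n - r)) \<le> M * (K r * indicator {..<T} r)"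
      proof (rule AE_I2)
        fix r
        show "norm (K r * w (u n - r)) \<le> M * (K r * indicator {..<T} r)"
        proof (cases "r < T")
          case True
          then show ?thesis
            using M[rule_format, of "max 0 (min T (u n - r))"] assms(2)
            by (simp add: w_def abs_mult K_def mult.commute[of M] mult_left_mono)
        next
          case False
          then have "w (u n - r) = 0" using u(1)[rule_format, of n] by (intro w0) auto
          then show ?thesis using False by simp
        qed
      qed
    qed measurable
  qed
  then show ?thesis
    by (rule continuous_on_eq) (simp only: eq)
qed

text \<open>Convolution with \<open>pow_kernel 1\<close> is integration up to \<open>t\<close>, so
  moving to \<open>t'\<close> adds at most \<open>c\<close> times the length. The additive form
  avoids the truncated subtraction of \<open>ennreal\<close>.\<close>

lemma primitive_kernel_lipschitz:
  fixes w :: "real \<Rightarrow> real"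
  assumes w: "\<And>s. w s \<le> c" "c \<ge> 0" and "t \<le> t'" and [measurable]: "w \<in> borel_measurable borel"
  shows "nn_conv (pow_kernel 1) (\<lambda>s. ennreal (indicator {0<..} s * w s)) t'
    \<le> nn_conv (pow_kernel 1) (\<lambda>s. ennreal (indicator {0<..} s * w s)) t + ennreal (c * (t' - t))"
proof -
  let ?h = "\<lambda>s. ennreal (indicator {0<..} s * w s)"
  have "nn_conv (pow_kernel 1) ?h t'
    \<le> (\<integral>\<^sup>+s. pow_kernel 1 (t - s) * ?h s + ennreal c * indicator {t..t'} s \<partial>lborel)"
    unfolding nn_conv_def
  proof (rule nn_integral_mono)
    fix s
    have "?h s \<le> ennreal c"
      using w by (intro ennreal_leI) (auto simp: indicator_def)
    then show "pow_kernel 1 (t' - s) * ?h s \<le> pow_kernel 1 (t - s) * ?h s + ennreal c * indicator {t..t'} s"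
      using assms(3) by (cases "s < t"; cases "s < t'") auto
  qed
  also have "\<dots> = nn_conv (pow_kernel 1) ?h t + ennreal c * ennreal (t' - t)"
    using assms(3) by (subst nn_integral_add) (auto simp: nn_conv_def nn_integral_cmult_indicator)
  finally show ?thesis
    using assms by (simp add: ennreal_mult)
qed

text \<open>Applying \<open>J\<^sup>a\<close> to \<open>J\<^sup>1\<^sup>-\<^sup>a w = J\<^sup>1 g\<close> gives \<open>J\<^sup>1\<^sup>+\<^sup>a g = J\<^sup>1 w\<close>, which is Lipschitz for bounded \<open>w\<close>.
  Adding the constant \<open>M\<close> to \<open>w\<close> keeps all convolutions within nonnegative functions.\<close>
lemma RL_integral_primitive_lipschitz:
  fixes g w :: "real \<Rightarrow> real"
  assumes a: "0 < a" "a < 1"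
    and [measurable]: "w \<in> borel_measurable borel" "g \<in> borel_measurable borel"
    and w: "\<And>s. \<bar>w s\<bar> \<le> M" "w 0 = 0"
    and g: "\<And>s. g s \<ge> 0" "\<And>s. s < 0 \<Longrightarrow> g s = 0"
    and int: "\<And>t. t \<in> {0..<T} \<Longrightarrow> (g has_integral RL_integral (1 - a) w t) {0..t}"
  shows "\<exists>C\<ge>0. \<forall>t\<in>{0..<T}. \<forall>t'\<in>{t..<T}.
    nn_conv (pow_kernel (a + 1)) (\<lambda>s. ennreal (g s)) t < \<infinity> \<and>
    nn_conv (pow_kernel (a + 1)) (\<lambda>s. ennreal (g s)) t'
      \<le> nn_conv (pow_kernel (a + 1)) (\<lambda>s. ennreal (g s)) t + ennreal (C * (t' - t))"
proof -
  define h where "h s = ennreal (indicator {0<..} s * (w s + M))" for s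
  define b where "b = 1 - a"
  have b: "b > 0" "a + b = 1" using a by (simp_all add: b_def)
  have M: "M \<ge> 0" using w(1)[of 0] w(2) by simp
  have wM: "w s + M \<ge> 0" "w s + M \<le> 2 * M" for s using w(1)[of s] by auto
  have [measurable]: "h \<in> borel_measurable borel" unfolding h_def by measurable
  define A where "A = nn_conv (pow_kernel (a + 1)) (\<lambda>s. ennreal (g s))"
  define H where "H = nn_conv (pow_kernel 1) h"
  let ?g = "\<lambda>s. ennreal (g s)" and ?P1 = "pow_kernel 1"
  \<comment> \<open>The hypothesis \<open>int\<close> in terms of unnormalised kernels:
    \<open>Gamma b\<close> undoes the factor in \<open>RL_integral\<close>, and the last term comes
    from the shift by \<open>M\<close>.\<close>
  have shifted: "nn_conv (pow_kernel b) h s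
    = ennreal (Gamma b) * nn_conv ?P1 ?g s + ennreal M * nn_conv (pow_kernel b) ?P1 s" if "s < T" for s
  proof (cases "s > 0")
    case False
    then show ?thesis
      using g(2) by (simp add: nn_conv_pow_kernel_nonpos h_def)
  next
    case True
    define R where "R = RL_integral b w s"
    define K where "K r = enn2real (pow_kernel b (s - r))" for r
    have gR: "(g has_integral R) {0..s}"
      using int[of s] True that by (simp add: R_def b_def)
    have "nn_conv ?P1 ?g s = (\<integral>\<^sup>+r. ennreal (g r) * indicator {0..<s} r \<partial>lborel)"
      unfolding nn_conv_def using g(2)
      by (intro nn_integral_cong) (auto simp: pow_kernel_def indicator_def)
    also have "\<dots> = (\<integral>\<^sup>+r. ennreal (g r) * indicator {0..s} r \<partial>lborel)"
      using AE_lborel_singleton[of s] by (intro nn_integral_cong_AE) (auto simp: indicator_def)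
    also have "\<dots> = ennreal R"
      by (rule nn_integral_has_integral_lebesgue'[OF _ gR]) (use g in auto)
    finally have G: "nn_conv ?P1 ?g s = ennreal R" .
    have R0: "R \<ge> 0" using has_integral_nonneg[OF gR] g(1) by blast
    have R: "Gamma b * R = (\<integral>r. K r * (indicator {0<..} r * w r) \<partial>lborel)"
      unfolding R_def K_def using w(2) Gamma_real_pos[OF b(1)]
      by (subst RL_integral_eq_convolution[of w]) simp_all
    have iK: "integrable lborel (\<lambda>r. K r * (indicator {0<..} r * v r))"
      if "v \<in> borel_measurable borel" "\<And>s. \<bar>v s\<bar> \<le> N" for v N
      unfolding K_def by (rule pow_kernel_convolution_integrable[OF b(1) that])
    have K: "pow_kernel b (s - r) = ennreal (K r)" for r
      by (simp add: K_def pow_kernel_def)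
    have [simp]: "K r \<ge> 0" for r by (simp add: K_def)
    define c where "c = (\<integral>r. K r * (indicator {0<..} r * 1) \<partial>lborel)"
    have c0: "c \<ge> 0" unfolding c_def by (intro integral_nonneg_AE) auto
    have "nn_conv (pow_kernel b) ?P1 s = (\<integral>\<^sup>+r. ennreal (K r * (indicator {0<..} r * 1)) \<partial>lborel)"
      unfolding nn_conv_def K by (intro nn_integral_cong) (auto simp: indicator_def pow_kernel_def)
    also have "\<dots> = ennreal c"
      unfolding c_def by (intro nn_integral_eq_integral iK[of "\<lambda>_. 1" 1]) auto
    finally have C: "nn_conv (pow_kernel b) ?P1 s = ennreal c" .
    have "nn_conv (pow_kernel b) h s = (\<integral>\<^sup>+r. ennreal (K r * (indicator {0<..} r * (w r + M))) \<partial>lborel)"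
      unfolding nn_conv_def K h_def by (intro nn_integral_cong) (simp add: ennreal_mult')
    \<comment> \<open>The passage to real integrals permits splitting off \<open>w\<close>, which
      may change sign.\<close>
    also have "\<dots> = ennreal (\<integral>r. K r * (indicator {0<..} r * (w r + M)) \<partial>lborel)"
      by (intro nn_integral_eq_integral iK[of _ "2 * M"]) (use wM in auto)
    also have "(\<lambda>r. K r * (indicator {0<..} r * (w r + M)))
        = (\<lambda>r. K r * (indicator {0<..} r * w r) + M * (K r * (indicator {0<..} r * 1)))"
      by (simp add: algebra_simps)
    also have "(\<integral>r. K r * (indicator {0<..} r * w r) + M * (K r * (indicator {0<..} r * 1)) \<partial>lborel)
        = Gamma b * R + M * c"
      unfolding R c_def
      by (subst Bochner_Integration.integral_add)
         (auto intro!: iK[of w M] integrable_mult_right iK[of "\<lambda>_. 1" 1] w simp del: mult_1_right)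
    finally show ?thesis
      using R0 c0 M b(1) Gamma_real_pos[of b] by (simp add: G C ennreal_mult ennreal_plus)
  qed
  define B where "B = Beta a b"
  define B1 where "B1 = Beta a 1"
  have pos: "B > 0" "B1 > 0" "Gamma b > 0"
    using a b by (auto simp: B_def B1_def Beta_def Gamma_real_pos)
  \<comment> \<open>Convolution of \<open>shifted\<close> with \<open>pow_kernel a\<close>: since
    \<open>a + b = 1\<close>, the kernels for \<open>h\<close> combine to
    \<open>pow_kernel 1\<close>, and those for \<open>g\<close> to
    \<open>pow_kernel (a + 1)\<close>.\<close>
  have identity: "ennreal B * H t = ennreal (Gamma b * B1) * A t + ennreal (M * B * t)"
    if t: "t \<in> {0..<T}" for t
  proof -
    have comp: "nn_conv (pow_kernel a) (nn_conv (pow_kernel b) f) t = ennreal B * nn_conv ?P1 f t"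
      if "f \<in> borel_measurable borel" for f
      using that a b(1) by (simp add: nn_conv_assoc nn_conv_pow_kernel b(2) B_def nn_conv_cmult)
    have "nn_conv ?P1 ?P1 t = ennreal t"
      using t by (cases "t = 0") (simp_all add: nn_conv_pow_kernel Beta_def Gamma_numeral)
    then have P1: "nn_conv (pow_kernel a) (nn_conv (pow_kernel b) ?P1) t = ennreal B * ennreal t"
      by (simp add: comp)
    have "ennreal B * H t = nn_conv (pow_kernel a) (nn_conv (pow_kernel b) h) t"
      by (simp add: comp H_def)
    also have "\<dots> = nn_conv (pow_kernel a)
        (\<lambda>s. ennreal (Gamma b) * nn_conv ?P1 ?g s + ennreal M * nn_conv (pow_kernel b) ?P1 s) t"
      using t by (intro nn_conv_pow_kernel_cong shifted) auto
    also have "\<dots> = ennreal (Gamma b) * nn_conv (pow_kernel a) (nn_conv ?P1 ?g) t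
        + ennreal M * nn_conv (pow_kernel a) (nn_conv (pow_kernel b) ?P1) t"
      by (subst nn_conv_add) (simp_all add: nn_conv_cmult)
    also have "nn_conv (pow_kernel a) (nn_conv ?P1 ?g) t = ennreal B1 * A t"
      using a by (simp add: nn_conv_assoc nn_conv_pow_kernel B1_def A_def nn_conv_cmult)
    finally show ?thesis
      using t M pos by (simp add: P1 ennreal_mult mult.assoc)
  qed
  have lip: "H t' \<le> H t + ennreal (2 * M * (t' - t))" if "t \<le> t'" for t t'
    unfolding H_def h_def by (rule primitive_kernel_lipschitz) (use wM M that in auto)
  have H0: "H 0 = 0"
    unfolding H_def by (rule nn_conv_pow_kernel_nonpos) (auto simp: h_def)
  have Hfin: "H t < \<infinity>" if "t \<ge> 0" for t
    using lip[OF that] H0 by (simp add: le_less_trans)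
  \<comment> \<open>Finiteness of \<open>H\<close> passes to \<open>A\<close> through the identity;
    afterwards the comparison can be made with real numbers.\<close>
  have Afin: "A t < \<infinity>" if "t \<in> {0..<T}" for t
  proof (rule ccontr)
    assume "\<not> A t < \<infinity>"
    then have "A t = top" by (simp add: less_top[symmetric])
    then have "ennreal B * H t = top"
      using identity[OF that] pos by (simp add: ennreal_mult_top)
    then show False
      using Hfin[of t] that by (auto simp: ennreal_mult_eq_top_iff)
  qed
  \<comment> \<open>\<open>H\<close> grows by at most \<open>2 * M * (t' - t)\<close>. Of the
    resulting \<open>2 * M * B\<close>, the shift term accounts for one \<open>M * B\<close>; the
    other is divided by the coefficient of \<open>A\<close>.\<close>
  have "A t' \<le> A t + ennreal (M * B / (Gamma b * B1) * (t' - t))" if "t \<in> {0..<T}" "t' \<in> {t..<T}" for t t'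
  proof -
    have t': "t' \<in> {0..<T}" "t \<le> t'" using that by auto
    have "A t < \<infinity>" "A t' < \<infinity>" using Afin that by auto
    then obtain x x' where x: "A t = ennreal x" "x \<ge> 0" and x': "A t' = ennreal x'" "x' \<ge> 0"
      by (cases "A t"; cases "A t'") auto
    have "ennreal B * H t' \<le> ennreal B * H t + ennreal B * ennreal (2 * M * (t' - t))"
      using mult_left_mono[OF lip[OF t'(2)], of "ennreal B"] by (simp add: distrib_left)
    then have "ennreal (Gamma b * B1 * x' + M * B * t')
      \<le> ennreal (Gamma b * B1 * x + M * B * t + B * (2 * M * (t' - t)))"
      using identity[OF that(1)] identity[OF t'(1)] pos x x' M that
      by (simp add: ennreal_mult'' ennreal_plus)
    then have "Gamma b * B1 * x' + M * B * t' \<le> Gamma b * B1 * x + M * B * t + B * (2 * M * (t' - t))"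
      using pos x x' M that by (subst (asm) ennreal_le_iff) auto
    then have "Gamma b * B1 * x' \<le> Gamma b * B1 * x + M * B * (t' - t)"
      by (simp add: algebra_simps)
    then have "x' \<le> x + M * B / (Gamma b * B1) * (t' - t)"
      using pos by (simp add: field_simps)
    then have "ennreal x' \<le> ennreal (x + M * B / (Gamma b * B1) * (t' - t))"
      by (rule ennreal_leI)
    then show ?thesis
      using x x' pos M that by (simp add: ennreal_plus)
  qed
  then show ?thesis
    using Afin pos M unfolding A_def[symmetric]
    by (intro exI[of _ "M * B / (Gamma b * B1)"] conjI ballI) auto
qed

section \<open>Nonexistence\<close>

text \<open>Mean value theorem: the derivative of the power decreases because \<open>a < 1\<close>,
  so its value at \<open>z\<close> bounds it from below on the whole interval.\<close>

lemma powr_increment_ge: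
  fixes a x y z :: real
  assumes "0 < a" "a < 1" "0 \<le> x" "x < y" "y \<le> z"
  shows "x powr a + a * (y - x) * z powr (a - 1) \<le> y powr a"
proof -
  have D: "((\<lambda>v. v powr a) has_real_derivative a * v powr (a - 1)) (at v)" if "v > 0" for v
    using that by (auto intro!: derivative_eq_intros)
  have "continuous_on {x..y} (\<lambda>v. v powr a)"
    using assms by (intro continuous_on_powr' continuous_intros) auto
  then obtain l v where v: "x < v" "v < y" "((\<lambda>v. v powr a) has_real_derivative l) (at v)"
    "y powr a - x powr a = (y - x) * l"
    using MVT[OF assms(4), of "\<lambda>v. v powr a"] D assms(3)
    by (metis le_less_trans real_differentiable_def)
  have "l = a * v powr (a - 1)"
    using DERIV_unique[OF v(3) D] v assms by simp
  moreover have "z powr (a - 1) \<le> v powr (a - 1)"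
    using v assms by (intro powr_mono2') auto
  ultimately have "(y - x) * (a * z powr (a - 1)) \<le> (y - x) * l"
    using assms by (intro mult_left_mono) auto
  with v(4) show ?thesis by (simp add: mult_ac)
qed

text \<open>For \<open>s \<le> t\<close> the increment of the kernel from \<open>t - s\<close> to
  \<open>t' - s\<close> is bounded below by its slope at \<open>T - s\<close>. Integrated against
  the weight, that slope gives the iterated logarithm, so the difference quotients exceed every
  bound as \<open>t\<close> approaches \<open>T\<close>.\<close>

lemma critical_weight_growth:
  assumes a: "0 < a" "a < 1" and t: "0 \<le> t" "t < t'" "t' < T"
  shows "nn_conv (pow_kernel (a + 1)) (\<lambda>s. ennreal (critical_weight T a s)) t
      + ennreal (a * (t' - t) * ln (1 + ln (T / (T - t))))
    \<le> nn_conv (pow_kernel (a + 1)) (\<lambda>s. ennreal (critical_weight T a s)) t'"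
proof -
  let ?g = "\<lambda>s. ennreal (critical_weight T a s)"
  let ?k = "\<lambda>s. ennreal ((T - s) powr (a - 1) * critical_weight T a s) * indicator {0..t} s"
  have L: "ennreal (a * (t' - t) * ln (1 + ln (T / (T - t)))) = ennreal (a * (t' - t)) * (\<integral>\<^sup>+s. ?k s \<partial>lborel)"
    using a t nn_integral_critical_weight[of t T a] by (simp add: ennreal_mult')
  have "nn_conv (pow_kernel (a + 1)) ?g t + ennreal (a * (t' - t) * ln (1 + ln (T / (T - t))))
    = (\<integral>\<^sup>+s. pow_kernel (a + 1) (t - s) * ?g s + ennreal (a * (t' - t)) * ?k s \<partial>lborel)"
    unfolding L by (simp add: nn_conv_def nn_integral_add nn_integral_cmult)
  also have "\<dots> \<le> nn_conv (pow_kernel (a + 1)) ?g t'"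
    unfolding nn_conv_def
  proof (rule nn_integral_mono)
    fix s
    consider "s < 0" | "s > t" | "0 \<le> s" "s \<le> t" by linarith
    then show "pow_kernel (a + 1) (t - s) * ?g s + ennreal (a * (t' - t)) * ?k s
      \<le> pow_kernel (a + 1) (t' - s) * ?g s"
    proof cases
      case 1
      then show ?thesis by (simp add: critical_weight_def)
    next
      case 2
      then show ?thesis by simp
    next
      case 3
      have k: "pow_kernel (a + 1) (t - s) = ennreal ((t - s) powr a)"
        "pow_kernel (a + 1) (t' - s) = ennreal ((t' - s) powr a)"
        using 3 t a by (auto simp: pow_kernel_def indicator_def)
      have "pow_kernel (a + 1) (t - s) * ?g s + ennreal (a * (t' - t)) * ?k s
        = ennreal (((t - s) powr a + a * (t' - t) * (T - s) powr (a - 1)) * critical_weight T a s)"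
        using 3 t a critical_weight_nonneg[of T a s]
        by (simp add: k distrib_right mult.assoc ennreal_plus ennreal_mult flip: ennreal_mult)
      also have "\<dots> \<le> ennreal ((t' - s) powr a * critical_weight T a s)"
        using powr_increment_ge[OF a, of "t - s" "t' - s" "T - s"] 3 t critical_weight_nonneg[of T a s]
        by (intro ennreal_leI mult_right_mono) auto
      finally show ?thesis
        using critical_weight_nonneg[of T a s] by (simp add: k ennreal_mult)
    qed
  qed
  finally show ?thesis .
qed

text \<open>The Lipschitz bound for \<open>A\<close> extracted from a continuous \<open>g\<close>
  contradicts the growth of \<open>A\<close> near \<open>T\<close>.\<close>

lemma critical_weight_no_continuous_solution:
  assumes T: "T > 0" and a: "0 < a" "a < 1"
    and g: "continuous_on {0..T} g" "g 0 = 0"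
    and d: "has_weak_deriv T (RL_integral (1 - a) g) d"
      "AE t in lebesgue_on {0..T}. d t = critical_weight T a t"
  shows False
proof -
  define w where "w s = g (max 0 (min T s))" for s
  have "continuous_on UNIV w"
    unfolding w_def using T by (intro continuous_on_compose2[OF g(1)] continuous_intros) auto
  then have w_borel: "w \<in> borel_measurable borel"
    by (rule borel_measurable_continuous_onI)
  obtain M where M: "\<forall>s\<in>{0..T}. \<bar>g s\<bar> \<le> M"
    using compact_imp_bounded[OF compact_continuous_image[OF g(1) compact_Icc]]
    by (auto simp: bounded_iff)
  have RL: "RL_integral (1 - a) w t = RL_integral (1 - a) g t" if "t \<in> {0..T}" for t
    unfolding RL_integral_def using that by (auto simp: w_def intro!: Bochner_Integration.integral_cong)
  have int: "(critical_weight T a has_integral RL_integral (1 - a) w t) {0..t}" if "t \<in> {0..<T}" for t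
  proof -
    have "(critical_weight T a has_integral RL_integral (1 - a) g t - RL_integral (1 - a) g 0) {0..t}"
      using a T g d that
      by (intro weak_deriv_continuous_has_integral[of T] continuous_on_RL_integral
          continuous_on_critical_weight) auto
    moreover have "RL_integral (1 - a) g 0 = 0"
      using RL_integral_eq_convolution[of "\<lambda>_. 0" 0 g "1 - a"] g(2) by simp
    ultimately show ?thesis using RL[of t] that by simp
  qed
  define A where "A = nn_conv (pow_kernel (a + 1)) (\<lambda>s. ennreal (critical_weight T a s))"
  have "\<exists>C\<ge>0. \<forall>t\<in>{0..<T}. \<forall>t'\<in>{t..<T}. A t < \<infinity> \<and> A t' \<le> A t + ennreal (C * (t' - t))"
    unfolding A_def
  proof (rule RL_integral_primitive_lipschitz[OF a w_borel _ _ _ _ _ int])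
    show "\<bar>w s\<bar> \<le> M" for s using M T by (simp add: w_def)
  qed (use g T in \<open>auto simp: w_def critical_weight_nonneg critical_weight_def[of _ _ s for s]\<close>)
  then obtain C where C: "C \<ge> 0"
    "\<And>t t'. t \<in> {0..<T} \<Longrightarrow> t' \<in> {t..<T} \<Longrightarrow> A t < \<infinity> \<and> A t' \<le> A t + ennreal (C * (t' - t))"
    by blast
  \<comment> \<open>Chosen so that \<open>a * ln c = C + 1\<close>; then \<open>t\<close> solves
    \<open>1 + ln (T / (T - t)) = c\<close>. The lower slope at \<open>t\<close> is thus exactly one
    more than the Lipschitz constant.\<close>
  define c where "c = exp ((C + 1) / a)"
  have c: "c > 1" using C(1) a by (simp add: c_def)
  define t where "t = T * (1 - exp (1 - c))"
  have "0 < exp (1 - c)" "exp (1 - c) < 1" using c by auto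
  then have t: "0 < t" "t < T"
    using T by (auto simp: t_def mult_less_cancel_left1 intro!: mult_pos_pos)
  have "T / (T - t) = exp (c - 1)"
    using T by (simp add: t_def algebra_simps exp_diff)
  then have L: "a * ln (1 + ln (T / (T - t))) = C + 1"
    using c a by (simp add: c_def)
  define t' where "t' = (t + T) / 2"
  have t': "t < t'" "t' < T" using t by (auto simp: t'_def)
  have "A t + ennreal ((t' - t) * (C + 1)) \<le> A t'"
    using critical_weight_growth[OF a _ t'] t unfolding A_def L[symmetric] by (simp add: mult_ac)
  also have "\<dots> \<le> A t + ennreal (C * (t' - t))"
    using C(2)[of t t'] t t' by simp
  finally have "ennreal ((t' - t) * (C + 1)) \<le> ennreal (C * (t' - t))"
    using C(2)[of t t'] t t' by (auto simp: ennreal_add_left_cancel_le)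
  then have "(t' - t) * (C + 1) \<le> C * (t' - t)"
    using C(1) t' by (subst (asm) ennreal_le_iff) auto
  then show False using t' by (simp add: algebra_simps)
qed

theorem theorem16:
  fixes T p :: real and \<alpha> :: "'n::finite \<Rightarrow> real"
  assumes "T > 0"
    and "p > 1"
    and "\<And>j. 0 < \<alpha> j \<and> \<alpha> j \<le> 1"
    and "\<exists>j0. \<alpha> j0 = 1 / p"
  shows "\<exists>(f :: real^'n \<Rightarrow> real \<Rightarrow> real^'n) (\<xi> :: real^'n).
    caratheodory T f \<and>
    (\<exists>\<gamma> :: real \<Rightarrow> real. \<exists>C > 0. in_Lp p T \<gamma> \<and>
      (AE t in lebesgue_on {0..T}. \<forall>x. norm (f x t) \<le> C * norm x + \<gamma> t)) \<and>
    \<not> (\<exists>\<phi> :: real \<Rightarrow> real^'n. caputo_solution p T \<alpha> f \<xi> \<phi>)"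
proof -
  obtain j0 where j0: "\<alpha> j0 = 1 / p" using assms(4) by blast
  define a where "a = 1 / p"
  have a: "0 < a" "a < 1" using assms(2) by (simp_all add: a_def)
  define f :: "real^'n \<Rightarrow> real \<Rightarrow> real^'n" where "f x t = axis j0 (critical_weight T a t)" for x t
  have Lp: "in_Lp p T (critical_weight T a)"
    using critical_weight_in_Lp[OF assms(1,2)] by (simp add: a_def)
  have f_eq: "f x t = critical_weight T a t *\<^sub>R axis j0 1" for x t
    by (simp add: f_def vec_eq_iff axis_def)
  have "caratheodory T f"
    using Lp by (auto simp: caratheodory_def f_eq in_Lp_def)
  moreover have "\<forall>x. norm (f x t) \<le> 1 * norm x + critical_weight T a t" for t
    by (simp add: f_eq critical_weight_nonneg)
  moreover have False if sol: "caputo_solution p T \<alpha> f 0 \<phi>" for \<phi>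
  proof -
    obtain D where D: "has_caputo_deriv (\<alpha> j0) T (\<lambda>t. \<phi> t $ j0) (\<lambda>t. D t $ j0)"
      "AE t in lebesgue_on {0..T}. D t $ j0 = f (\<phi> t) t $ j0"
      using sol by (auto simp: caputo_solution_def)
    show False
    proof (rule critical_weight_no_continuous_solution[OF assms(1) a])
      show "continuous_on {0..T} (\<lambda>s. \<phi> s $ j0 - \<phi> 0 $ j0)"
        using sol by (auto simp: caputo_solution_def intro!: continuous_intros)
      \<comment> \<open>As \<open>1 / p < 1\<close>, the Caputo derivative of component
        \<open>j0\<close> is the fractional one, which already subtracts the initial value.\<close>
      show "has_weak_deriv T (RL_integral (1 - a) (\<lambda>s. \<phi> s $ j0 - \<phi> 0 $ j0)) (\<lambda>t. D t $ j0)"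
        using D(1) a j0 by (simp add: has_caputo_deriv_def a_def)
      show "AE t in lebesgue_on {0..T}. D t $ j0 = critical_weight T a t"
        using D(2) by (simp add: f_def)
    qed simp
  qed
  ultimately show ?thesis
    using Lp by (intro exI[of _ f] exI[of _ 0] conjI exI[of _ "critical_weight T a"] exI[of _ 1]) auto
qed

end
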